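(* Let $K$ be a locally compact Hausdorff space and let $X$ be a Banach space over $\mathbb{K}\in\{\mathbb{R},\mathbb{C}\}$. An element $f\in C_0(K,X)$ is smooth if and only if $M_f=\{k_0\}$ for some $k_0\in K$ and $f(k_0)$ is a smooth point of $X$.
   Context: $C_0(K,X)$ denotes the Banach space (over $\mathbb{K}$) of continuous functions $f:K\to X$ vanishing at infinity, with the supremum norm $\|f\|=\sup_{k\in K}\|f(k)\|$. For $f\in C_0(K,X)$, $M_f=\{k\in K:\|f(k)\|=\|f\|\}$. A non-zero element $x$ of a Banach space $Y$ is smooth (a smooth point of $Y$) if there exists a unique $\varphi\in Y^*$ with $\|\varphi\|=1$ and $\varphi(x)=\|x\|$; the zero vector is not considered smooth. *)

theory Defs
  imports "HOL-Analysis.Analysis"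
begin

section \<open>Banach spaces over a scalar field\<close>

text \<open>The library only has real normed spaces. A Banach space over a normed field (used for
  \<open>\<real>\<close> and \<open>\<complex>\<close>) is a real Banach space with a scalar multiplication that extends the
  real one and for which the norm is homogeneous.\<close>

locale banach_space_over = vector_space smul
  for smul :: "'s::real_normed_field \<Rightarrow> 'y::banach \<Rightarrow> 'y" +
  assumes smul_of_real: "smul (of_real r) y = r *\<^sub>R y"
    and norm_smul: "norm (smul c y) = norm c * norm y"

lemma banach_space_over_scaleR: "banach_space_over (scaleR :: real \<Rightarrow> 'y::banach \<Rightarrow> 'y)"
  by unfold_locales (auto simp: algebra_simps)

text \<open>A functional that is linear over \<open>'s\<close> and bounded is in particular a bounded real-linear map
  into \<open>'s\<close>; its norm as an element of the dual is the operator norm of that real-linear map.\<close>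

definition dual_space :: "('s::real_normed_field \<Rightarrow> 'y::real_normed_vector \<Rightarrow> 'y) \<Rightarrow> ('y \<Rightarrow>\<^sub>L 's) set"
  where "dual_space smul = {\<phi>. \<forall>c y. blinfun_apply \<phi> (smul c y) = c * blinfun_apply \<phi> y}"

definition smooth_point :: "('s::real_normed_field \<Rightarrow> 'y::real_normed_vector \<Rightarrow> 'y) \<Rightarrow> 'y \<Rightarrow> bool"
  where "smooth_point smul x \<longleftrightarrow>
    x \<noteq> 0 \<and> (\<exists>!\<phi>. \<phi> \<in> dual_space smul \<and> norm \<phi> = 1 \<and> blinfun_apply \<phi> x = of_real (norm x))"


section \<open>Continuous functions vanishing at infinity\<close>

definition vanishes_at_infinity :: "('k::topological_space \<Rightarrow> 'x::real_normed_vector) \<Rightarrow> bool"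
  where "vanishes_at_infinity f \<longleftrightarrow> (\<forall>e>0. compact {k. e \<le> norm (f k)})"

typedef (overloaded) ('k, 'x) czero =
  "{f :: 'k::topological_space \<Rightarrow> 'x::real_normed_vector.
      continuous_on UNIV f \<and> vanishes_at_infinity f}"
  morphisms apply_czero Czero
proof
  have "{k::'k. e \<le> norm (0::'x)} = {}" if "e > 0" for e
    using that by auto
  then show "(\<lambda>_. 0) \<in> {f :: 'k \<Rightarrow> 'x. continuous_on UNIV f \<and> vanishes_at_infinity f}"
    by (auto simp: vanishes_at_infinity_def)
qed

setup_lifting type_definition_czero

lemma continuous_on_apply_czero: "continuous_on UNIV (apply_czero f)"
  and vanishes_apply_czero: "vanishes_at_infinity (apply_czero f)"
  using apply_czero[of f] by auto

lemma czero_eqI: "(\<And>k. apply_czero f k = apply_czero g k) \<Longrightarrow> f = g"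
  by transfer auto

lemma vanishes_at_infinityI:
  fixes f :: "'k::topological_space \<Rightarrow> 'x::real_normed_vector"
  assumes "continuous_on UNIV f"
    and "\<And>e. e > 0 \<Longrightarrow> \<exists>C. compact C \<and> {k. e \<le> norm (f k)} \<subseteq> C"
  shows "vanishes_at_infinity f"
  unfolding vanishes_at_infinity_def
proof (intro allI impI)
  fix e :: real assume "e > 0"
  then obtain C where C: "compact C" "{k. e \<le> norm (f k)} \<subseteq> C"
    using assms(2) by blast
  have "closed {k. e \<le> norm (f k)}"
    by (intro closed_Collect_le continuous_intros assms(1))
  then have "compact (C \<inter> {k. e \<le> norm (f k)})"
    using C(1) by (rule compact_Int_closed[rotated])
  then show "compact {k. e \<le> norm (f k)}"
    using C(2) by (simp add: Int_absorb1)
qed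

lemma vanishes_add:
  assumes "continuous_on UNIV f" "continuous_on UNIV g"
    and "vanishes_at_infinity f" "vanishes_at_infinity g"
  shows "vanishes_at_infinity (\<lambda>k. f k + g k)"
proof (rule vanishes_at_infinityI)
  show "continuous_on UNIV (\<lambda>k. f k + g k)"
    by (intro continuous_intros assms)
next
  fix e :: real assume "e > 0"
  then have "e/2 > 0"
    by simp
  then have "compact ({k. e/2 \<le> norm (f k)} \<union> {k. e/2 \<le> norm (g k)})"
    using assms(3,4) unfolding vanishes_at_infinity_def by (blast intro: compact_Un)
  moreover have "{k. e \<le> norm (f k + g k)} \<subseteq> {k. e/2 \<le> norm (f k)} \<union> {k. e/2 \<le> norm (g k)}"
  proof clarsimp
    fix k assume "e \<le> norm (f k + g k)" "\<not> e \<le> norm (g k) * 2"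
    then show "e \<le> norm (f k) * 2"
      using norm_triangle_ineq[of "f k" "g k"] by linarith
  qed
  ultimately show "\<exists>C. compact C \<and> {k. e \<le> norm (f k + g k)} \<subseteq> C"
    by blast
qed

lemma vanishes_bounded:
  assumes "continuous_on UNIV g" and "vanishes_at_infinity f"
    and "\<And>k. norm (g k) \<le> b * norm (f k)"
  shows "vanishes_at_infinity g"
proof (rule vanishes_at_infinityI)
  fix e :: real assume "e > 0"
  define c where "c = max b 1"
  have "c > 0" "norm (g k) \<le> c * norm (f k)" for k
    using assms(3)[of k] mult_right_mono[of b c "norm (f k)"] by (auto simp: c_def)
  then have "{k. e \<le> norm (g k)} \<subseteq> {k. e / c \<le> norm (f k)}"
    by (auto simp: field_simps intro: order_trans)
  moreover have "compact {k. e / c \<le> norm (f k)}"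
    using assms(2) \<open>e > 0\<close> \<open>c > 0\<close> by (simp add: vanishes_at_infinity_def)
  ultimately show "\<exists>C. compact C \<and> {k. e \<le> norm (g k)} \<subseteq> C"
    by blast
qed (rule assms(1))

lemma bdd_above_norm_czero: "bdd_above (range (\<lambda>k. norm (apply_czero f k)))"
proof -
  have "compact {k. 1 \<le> norm (apply_czero f k)}"
    using vanishes_apply_czero[of f] by (simp add: vanishes_at_infinity_def)
  then have "compact (apply_czero f ` {k. 1 \<le> norm (apply_czero f k)})"
    by (intro compact_continuous_image continuous_on_subset[OF continuous_on_apply_czero]) auto
  then obtain b where b: "\<And>k. 1 \<le> norm (apply_czero f k) \<Longrightarrow> norm (apply_czero f k) \<le> b"
    by (force dest!: compact_imp_bounded simp: bounded_iff)
  have "norm (apply_czero f k) \<le> max 1 b" for k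
    using b[of k] by linarith
  then show ?thesis
    by (auto simp: bdd_above_def)
qed

instantiation czero :: (topological_space, real_normed_vector) real_vector
begin

lift_definition zero_czero :: "('a, 'b) czero" is "\<lambda>_. 0"
  by (auto simp: vanishes_at_infinity_def)

lift_definition plus_czero :: "('a, 'b) czero \<Rightarrow> ('a, 'b) czero \<Rightarrow> ('a, 'b) czero"
  is "\<lambda>f g k. f k + g k"
  by (auto intro!: continuous_intros vanishes_add)

lift_definition uminus_czero :: "('a, 'b) czero \<Rightarrow> ('a, 'b) czero" is "\<lambda>f k. - f k"
  by (auto intro!: continuous_intros elim: vanishes_bounded[where b=1, rotated])

lift_definition minus_czero :: "('a, 'b) czero \<Rightarrow> ('a, 'b) czero \<Rightarrow> ('a, 'b) czero"
  is "\<lambda>f g k. f k - g k"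
proof safe
  fix f g :: "'a \<Rightarrow> 'b"
  assume *: "continuous_on UNIV f" "vanishes_at_infinity f"
    "continuous_on UNIV g" "vanishes_at_infinity g"
  then show "continuous_on UNIV (\<lambda>k. f k - g k)"
    by (intro continuous_intros)
  have "vanishes_at_infinity (\<lambda>k. - g k)"
    by (rule vanishes_bounded[OF _ *(4), of _ 1]) (auto intro!: continuous_intros *)
  then show "vanishes_at_infinity (\<lambda>k. f k - g k)"
    using vanishes_add[of f "\<lambda>k. - g k"] * by (simp add: continuous_on_minus)
qed

lift_definition scaleR_czero :: "real \<Rightarrow> ('a, 'b) czero \<Rightarrow> ('a, 'b) czero"
  is "\<lambda>r f k. r *\<^sub>R f k"
proof safe
  fix r :: real and f :: "'a \<Rightarrow> 'b"
  assume *: "continuous_on UNIV f" "vanishes_at_infinity f"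
  then show "continuous_on UNIV (\<lambda>k. r *\<^sub>R f k)"
    by (intro continuous_intros)
  then show "vanishes_at_infinity (\<lambda>k. r *\<^sub>R f k)"
    by (rule vanishes_bounded[OF _ *(2), of _ "\<bar>r\<bar>"]) auto
qed

instance
  by standard (transfer; auto simp: algebra_simps)+

end

lemmas czero_apply [simp] =
  zero_czero.rep_eq plus_czero.rep_eq uminus_czero.rep_eq minus_czero.rep_eq scaleR_czero.rep_eq

instantiation czero :: (topological_space, real_normed_vector) real_normed_vector
begin

definition norm_czero :: "('a, 'b) czero \<Rightarrow> real"
  where "norm_czero f = (SUP k. norm (apply_czero f k))"

definition dist_czero :: "('a, 'b) czero \<Rightarrow> ('a, 'b) czero \<Rightarrow> real"
  where "dist_czero f g = norm (f - g)"

definition sgn_czero :: "('a, 'b) czero \<Rightarrow> ('a, 'b) czero"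
  where "sgn_czero f = f /\<^sub>R norm f"

definition uniformity_czero :: "(('a, 'b) czero \<times> ('a, 'b) czero) filter"
  where "uniformity_czero = (INF e\<in>{0 <..}. principal {(f, g). dist f g < e})"

definition open_czero :: "('a, 'b) czero set \<Rightarrow> bool"
  where "open_czero S = (\<forall>f\<in>S. \<forall>\<^sub>F (f', g) in uniformity. f' = f \<longrightarrow> g \<in> S)"

lemma norm_czero_upper: "norm (apply_czero f k) \<le> norm f"
  unfolding norm_czero_def by (rule cSUP_upper[OF UNIV_I bdd_above_norm_czero])

lemma norm_czero_least: "(\<And>k. norm (apply_czero f k) \<le> b) \<Longrightarrow> norm f \<le> b"
  unfolding norm_czero_def by (rule cSUP_least) auto

instance
proof
  fix f g :: "('a, 'b) czero" and r :: real
  show "(norm f = 0) = (f = 0)"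
  proof
    assume "norm f = 0"
    then show "f = 0"
      using norm_czero_upper[of f] by (intro czero_eqI) simp
  qed (simp add: norm_czero_def)
  show "norm (f + g) \<le> norm f + norm g"
    by (rule norm_czero_least)
      (auto intro!: norm_triangle_le add_mono norm_czero_upper)
  have le: "norm (r *\<^sub>R f) \<le> \<bar>r\<bar> * norm f" for r and f :: "('a, 'b) czero"
    by (rule norm_czero_least) (auto intro!: mult_left_mono norm_czero_upper)
  show "norm (r *\<^sub>R f) = \<bar>r\<bar> * norm f"
  proof (cases "r = 0")
    case False
    have "norm f \<le> \<bar>inverse r\<bar> * norm (r *\<^sub>R f)"
      using le[of "inverse r" "r *\<^sub>R f"] False by simp
    then have "\<bar>r\<bar> * norm f \<le> norm (r *\<^sub>R f)"
      using False by (simp add: field_simps)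
    then show ?thesis
      using le[of r f] by simp
  qed (simp add: norm_czero_def)
qed (rule dist_czero_def sgn_czero_def uniformity_czero_def open_czero_def)+

end

instance czero :: (topological_space, banach) banach
proof
  fix F :: "nat \<Rightarrow> ('a, 'b) czero"
  assume cauchy: "Cauchy F"
  have dist_le: "dist (apply_czero f k) (apply_czero g k) \<le> dist f g"
    for f g :: "('a, 'b) czero" and k
    using norm_czero_upper[of "f - g" k] by (simp add: dist_norm)
  obtain l where l: "uniform_limit UNIV (\<lambda>n. apply_czero (F n)) l sequentially"
    using uniformly_convergent_eq_cauchy[of "\<lambda>_. True" "\<lambda>n. apply_czero (F n)"] cauchy dist_le
    unfolding Cauchy_def uniform_limit_sequentially_iff by (metis le_less_trans)
  have cont: "continuous_on UNIV l"
    by (rule uniform_limit_theorem[OF _ l]) (simp_all add: continuous_on_apply_czero)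
  have "vanishes_at_infinity l"
  proof (rule vanishes_at_infinityI[OF cont])
    fix e :: real assume "e > 0"
    then obtain n where n: "\<And>k. dist (apply_czero (F n) k) (l k) < e/2"
      using l unfolding uniform_limit_sequentially_iff by (metis UNIV_I half_gt_zero order_refl)
    have "{k. e \<le> norm (l k)} \<subseteq> {k. e/2 \<le> norm (apply_czero (F n) k)}"
    proof (intro subsetI CollectI)
      fix k assume "k \<in> {k. e \<le> norm (l k)}"
      then show "e/2 \<le> norm (apply_czero (F n) k)"
        using n[of k] norm_triangle_ineq2[of "l k" "apply_czero (F n) k"]
        by (simp add: dist_norm norm_minus_commute)
    qed
    moreover have "compact {k. e/2 \<le> norm (apply_czero (F n) k)}"
      using vanishes_apply_czero[of "F n"] half_gt_zero[OF \<open>e > 0\<close>]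
      unfolding vanishes_at_infinity_def by blast
    ultimately show "\<exists>C. compact C \<and> {k. e \<le> norm (l k)} \<subseteq> C"
      by blast
  qed
  then obtain L where L: "l = apply_czero L"
    using cont by (metis (mono_tags, lifting) Czero_inverse mem_Collect_eq)
  have "F \<longlonglongrightarrow> L"
  proof (rule tendstoI)
    fix e :: real assume "e > 0"
    then have "\<forall>\<^sub>F n in sequentially. \<forall>k\<in>UNIV. dist (apply_czero (F n) k) (l k) < e/2"
      by (intro uniform_limitD[OF l]) simp
    then show "\<forall>\<^sub>F n in sequentially. dist (F n) L < e"
    proof eventually_elim
      case (elim n)
      then have "norm (F n - L) \<le> e/2"
        by (intro norm_czero_least) (auto simp: L dist_norm intro: less_imp_le)
      then show ?case
        using \<open>e > 0\<close> by (simp add: dist_norm)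
    qed
  qed
  then show "convergent F"
    by (rule convergentI)
qed


subsection \<open>Pointwise scalar multiplication\<close>

text \<open>Meaningful when \<open>smul\<close> satisfies \<^locale>\<open>banach_space_over\<close>, so that the pointwise multiple
  is again continuous and vanishes at infinity (see \<open>apply_czero_scale\<close> below).\<close>

definition czero_scale ::
  "('s \<Rightarrow> 'x::real_normed_vector \<Rightarrow> 'x) \<Rightarrow> 's \<Rightarrow> ('k::topological_space, 'x) czero \<Rightarrow> ('k, 'x) czero"
  where "czero_scale smul c f = Czero (\<lambda>k. smul c (apply_czero f k))"

lemma czero_scale_scaleR: "czero_scale scaleR = scaleR"
  by (intro ext) (simp add: czero_scale_def scaleR_czero_def)

context banach_space_over
begin

lemma bounded_linear_scale: "bounded_linear (smul c)"
proof (rule bounded_linear_intro[of _ "norm c"])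
  fix r y
  show "smul c (r *\<^sub>R y) = r *\<^sub>R smul c y"
    by (metis smul_of_real scale_left_commute)
qed (auto simp: scale_right_distrib norm_smul mult.commute)

lemma apply_czero_scale: "apply_czero (czero_scale smul c f) k = smul c (apply_czero f k)"
proof -
  have cont: "continuous_on UNIV (\<lambda>k. smul c (apply_czero f k))"
    by (rule bounded_linear.continuous_on[OF bounded_linear_scale continuous_on_apply_czero])
  moreover have "vanishes_at_infinity (\<lambda>k. smul c (apply_czero f k))"
    by (rule vanishes_bounded[OF cont vanishes_apply_czero[of f], where b="norm c"]) (simp add: norm_smul)
  ultimately show ?thesis
    by (simp add: czero_scale_def Czero_inverse)
qed

lemma banach_space_over_czero_scale:
  "banach_space_over (czero_scale smul :: 's \<Rightarrow> ('k::topological_space, 'y) czero \<Rightarrow> ('k, 'y) czero)"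
proof
  fix a b c :: 's and r :: real and f g :: "('k, 'y) czero"
  show "czero_scale smul a (f + g) = czero_scale smul a f + czero_scale smul a g"
    "czero_scale smul (a + b) f = czero_scale smul a f + czero_scale smul b f"
    "czero_scale smul a (czero_scale smul b f) = czero_scale smul (a * b) f"
    "czero_scale smul 1 f = f"
    "czero_scale smul (of_real r) f = r *\<^sub>R f"
    by (auto intro!: czero_eqI
        simp: apply_czero_scale scale_right_distrib scale_left_distrib smul_of_real)
  have le: "norm (czero_scale smul c f) \<le> norm c * norm f" for c :: 's and f :: "('k, 'y) czero"
    by (rule norm_czero_least)
      (auto simp: apply_czero_scale norm_smul intro!: mult_left_mono norm_czero_upper)
  show "norm (czero_scale smul c f) = norm c * norm f"
  proof (cases "c = 0")
    case True
    then have "czero_scale smul c f = 0"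
      by (intro czero_eqI) (simp add: apply_czero_scale)
    then show ?thesis
      using True by simp
  next
    case False
    then have "czero_scale smul (inverse c) (czero_scale smul c f) = f"
      by (intro czero_eqI) (simp add: apply_czero_scale)
    then have "norm f \<le> norm (inverse c) * norm (czero_scale smul c f)"
      using le[of "inverse c" "czero_scale smul c f"] by simp
    then have "norm c * norm f \<le> norm (czero_scale smul c f)"
      using False by (simp add: norm_inverse norm_divide field_simps)
    then show ?thesis
      using le[of c f] by simp
  qed
qed

end

definition norm_attaining_set :: "('k::topological_space, 'x::real_normed_vector) czero \<Rightarrow> 'k set"
  where "norm_attaining_set f = {k. norm (apply_czero f k) = norm f}"

end

theory Submission
  imports Defs
begin

text \<open>The proof identifies the support functionals of \<open>f\<close>, that is the functionals \<open>\<phi>\<close> of norm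
  \<open>1\<close> with \<open>\<phi> f = norm f\<close>; smoothness says that there is exactly one.

  Complex scalars reduce to real ones: \<open>\<phi> \<mapsto> Re \<circ> \<phi>\<close> is a bijection from complex to real support
  functionals, so both notions of smoothness agree (\<open>smooth_point_complex_iff_real\<close>). This applies
  to the range space and to the function space alike.

  Suppose that \<open>f\<close> is smooth, and call a point where \<open>norm (f k)\<close> attains \<open>norm f\<close> a peak. Peaks
  exist because \<open>f\<close> vanishes at infinity. For every peak \<open>k\<close> and every support functional \<open>\<psi>\<close> of
  \<open>f k\<close> the map \<open>g \<mapsto> \<psi> (g k)\<close> is a support functional of \<open>f\<close> (\<open>support_functional_eval\<close>), and \<open>\<psi>\<close>
  exists by the Hahn-Banach theorem (\<open>support_functional_exists\<close>). Two different peaks would give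
  different functionals, since a function \<open>w f\<close> with a continuous weight \<open>w\<close> can vanish at one peak
  and agree with \<open>f\<close> at the other. At a single peak, different \<open>\<psi>\<close> would give different
  functionals, since the functions \<open>k \<mapsto> norm (f k) x\<close> take all directions \<open>x\<close> there.

  Conversely, let \<open>k\<^sub>0\<close> be the only peak and \<open>\<phi>\<close> a support functional of \<open>f\<close>. Then \<open>\<phi>\<close> sees only the
  value at \<open>k\<^sub>0\<close>. If \<open>g\<close> vanishes near \<open>k\<^sub>0\<close>, small multiples of \<open>g\<close> can be added to \<open>f\<close> without
  raising the norm, so \<open>\<phi> g = 0\<close> (\<open>support_functional_zero_near_peak\<close>); functions that only vanish
  at \<open>k\<^sub>0\<close> are uniform limits of such \<open>g\<close> (\<open>support_functional_zero_at_peak\<close>). Hence \<open>\<phi>\<close> is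
  \<open>g \<mapsto> \<psi> (g k\<^sub>0)\<close> for a support functional \<open>\<psi>\<close> of \<open>f k\<^sub>0\<close> (\<open>support_functional_is_eval\<close>), and \<open>\<psi>\<close> is
  unique when \<open>f k\<^sub>0\<close> is smooth.\<close>


section \<open>Norming functionals\<close>

definition sublinear :: "('a::real_vector \<Rightarrow> real) \<Rightarrow> bool"
  where "sublinear q \<longleftrightarrow> (\<forall>x y. q (x + y) \<le> q x + q y) \<and> (\<forall>c>0. \<forall>x. q (c *\<^sub>R x) = c * q x)"

lemma sublinear_add: "sublinear q \<Longrightarrow> q (x + y) \<le> q x + q y"
  by (simp add: sublinear_def)

lemma sublinear_zero:
  assumes "sublinear q"
  shows "q 0 = 0"
proof -
  have "\<forall>c>0. \<forall>x. q (c *\<^sub>R x) = c * q x"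
    using assms by (simp add: sublinear_def)
  from this[rule_format, of 2 0] show ?thesis
    by simp
qed

lemma sublinear_scaleR:
  assumes "sublinear q" "c \<ge> 0"
  shows "q (c *\<^sub>R x) = c * q x"
  using assms sublinear_zero[OF assms(1)] by (cases "c = 0") (auto simp: sublinear_def)

lemma sublinear_ge_minus: "sublinear q \<Longrightarrow> - q (- x) \<le> q x"
  using sublinear_add[of q x "- x"] sublinear_zero[of q] by simp

text \<open>Since \<open>c\<close> may be replaced by its inverse, an inequality suffices for positive homogeneity.\<close>

lemma sublinearI:
  assumes "\<And>x y. q (x + y) \<le> q x + q y" and "\<And>c x. c > 0 \<Longrightarrow> q (c *\<^sub>R x) \<le> c * q x"
  shows "sublinear q"
  unfolding sublinear_def
proof (intro conjI allI impI antisym assms)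
  fix c :: real and x
  assume "c > 0"
  then have "q (inverse c *\<^sub>R (c *\<^sub>R x)) \<le> inverse c * q (c *\<^sub>R x)"
    by (intro assms(2)) simp
  with \<open>c > 0\<close> show "c * q x \<le> q (c *\<^sub>R x)"
    by (simp add: field_simps)
qed

lemma sublinear_norm: "sublinear norm"
  by (simp add: sublinear_def norm_triangle_ineq)

text \<open>The greatest sublinear functional below \<open>q\<close> whose value at \<open>- y\<close> is at most \<open>- q y\<close>, so that
  every linear functional below it agrees with \<open>q\<close> at \<open>y\<close>.\<close>

definition tilt :: "('a::real_vector \<Rightarrow> real) \<Rightarrow> 'a \<Rightarrow> 'a \<Rightarrow> real"
  where "tilt q y x = (INF t\<in>{0..}. q (x + t *\<^sub>R y) - t * q y)"

lemma tilt_lower: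
  assumes "sublinear q" "t \<ge> 0"
  shows "tilt q y x \<le> q (x + t *\<^sub>R y) - t * q y"
  unfolding tilt_def
proof (rule cINF_lower)
  have "- q (- x) \<le> q (x + t *\<^sub>R y) - t * q y" if "t \<ge> 0" for t
    using sublinear_add[OF assms(1), of "x + t *\<^sub>R y" "- x"]
      sublinear_scaleR[OF assms(1) that, of y] by simp
  then show "bdd_below ((\<lambda>t. q (x + t *\<^sub>R y) - t * q y) ` {0..})"
    by (auto simp: bdd_below_def)
qed (use assms in auto)

lemma tilt_greatest:
  "(\<And>t. t \<ge> 0 \<Longrightarrow> b \<le> q (x + t *\<^sub>R y) - t * q y) \<Longrightarrow> b \<le> tilt q y x"
  unfolding tilt_def by (rule cINF_greatest) auto

lemma tilt_le: "sublinear q \<Longrightarrow> tilt q y x \<le> q x"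
  using tilt_lower[of q 0 y x] by simp

lemma tilt_minus: "sublinear q \<Longrightarrow> tilt q y (- y) \<le> - q y"
  using tilt_lower[of q 1 y "- y"] by (simp add: sublinear_zero)

lemma sublinear_tilt:
  assumes "sublinear q"
  shows "sublinear (tilt q y)"
proof (rule sublinearI)
  fix u v
  have "tilt q y (u + v) - tilt q y v \<le> tilt q y u"
  proof (rule tilt_greatest)
    fix s :: real assume "s \<ge> 0"
    have "tilt q y (u + v) - (q (u + s *\<^sub>R y) - s * q y) \<le> tilt q y v"
    proof (rule tilt_greatest)
      fix t :: real assume "t \<ge> 0"
      have "tilt q y (u + v) \<le> q (u + v + (s + t) *\<^sub>R y) - (s + t) * q y"
        using \<open>s \<ge> 0\<close> \<open>t \<ge> 0\<close> by (intro tilt_lower assms) simp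
      also have "u + v + (s + t) *\<^sub>R y = (u + s *\<^sub>R y) + (v + t *\<^sub>R y)"
        by (simp add: algebra_simps)
      finally show "tilt q y (u + v) - (q (u + s *\<^sub>R y) - s * q y) \<le> q (v + t *\<^sub>R y) - t * q y"
        using sublinear_add[OF assms, of "u + s *\<^sub>R y" "v + t *\<^sub>R y"]
        by (simp add: algebra_simps)
    qed
    then show "tilt q y (u + v) - tilt q y v \<le> q (u + s *\<^sub>R y) - s * q y"
      by simp
  qed
  then show "tilt q y (u + v) \<le> tilt q y u + tilt q y v"
    by simp
next
  fix c :: real and x
  assume "c > 0"
  have "tilt q y (c *\<^sub>R x) / c \<le> tilt q y x"
  proof (rule tilt_greatest)
    fix t :: real assume "t \<ge> 0"
    have "tilt q y (c *\<^sub>R x) \<le> q (c *\<^sub>R x + (c * t) *\<^sub>R y) - (c * t) * q y"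
      using \<open>c > 0\<close> \<open>t \<ge> 0\<close> by (intro tilt_lower assms) simp
    also have "c *\<^sub>R x + (c * t) *\<^sub>R y = c *\<^sub>R (x + t *\<^sub>R y)"
      by (simp add: algebra_simps)
    finally show "tilt q y (c *\<^sub>R x) / c \<le> q (x + t *\<^sub>R y) - t * q y"
      using \<open>c > 0\<close> sublinear_scaleR[OF assms, of c "x + t *\<^sub>R y"]
      by (simp add: field_simps)
  qed
  then show "tilt q y (c *\<^sub>R x) \<le> c * tilt q y x"
    using \<open>c > 0\<close> by (simp add: field_simps)
qed

text \<open>A minimal sublinear functional agrees with all its tilts, so it is odd at every point; an
  odd subadditive functional is additive. Zorn's lemma supplies minimal elements because the
  pointwise infimum of a chain is again sublinear.\<close>

theorem linear_below_sublinear: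
  fixes p :: "'a::real_vector \<Rightarrow> real"
  assumes p: "sublinear p"
  obtains q where "linear q" "\<And>x. q x \<le> p x"
proof -
  define A where "A = {q. sublinear q \<and> q \<le> p}"
  have "\<exists>m\<in>A. \<forall>a\<in>A. m \<ge> a \<longrightarrow> a = m"
  proof (rule predicate_Zorn)
    show "partial_order_on A (relation_of (\<ge>) A)"
      by (rule partial_order_on_relation_ofI) auto
  next
    fix C assume C: "C \<in> Chains (relation_of (\<ge>) A)"
    then have CA: "sublinear q" "q \<le> p" if "q \<in> C" for q
      using that unfolding Chains_def relation_of_def A_def by auto
    have total: "q \<le> r \<or> r \<le> q" if "q \<in> C" "r \<in> C" for q r
      using that C unfolding Chains_def relation_of_def by auto
    show "\<exists>u\<in>A. \<forall>a\<in>C. u \<le> a"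
    proof (cases "C = {}")
      case True
      with p show ?thesis
        by (auto simp: A_def)
    next
      case False
      define u where "u x = (INF q\<in>C. q x)" for x
      have "- p (- x) \<le> q x" if "q \<in> C" for q x
        using CA[OF that] sublinear_ge_minus[of q x] le_funD[of q p "- x"] by linarith
      then have "bdd_below ((\<lambda>q. q x) ` C)" for x
        by (auto simp: bdd_below_def)
      then have lower: "u x \<le> q x" if "q \<in> C" for q x
        unfolding u_def using that by (rule cINF_lower)
      have greatest: "b \<le> u x" if "\<And>q. q \<in> C \<Longrightarrow> b \<le> q x" for b x
        unfolding u_def using False that by (rule cINF_greatest)
      have "sublinear u"
      proof (rule sublinearI)
        fix x y
        have *: "u (x + y) \<le> q x + r y" if qr: "q \<in> C" "r \<in> C" for q r
        proof -
          obtain s where s: "s \<in> C" "s \<le> q" "s \<le> r"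
            using total[OF qr] qr by blast
          show ?thesis
            using lower[OF s(1), of "x + y"] sublinear_add[OF CA(1)[OF s(1)], of x y]
              le_funD[OF s(2), of x] le_funD[OF s(3), of y] by linarith
        qed
        have "u (x + y) - u y \<le> u x"
        proof (rule greatest)
          fix q assume "q \<in> C"
          then have "u (x + y) - q x \<le> u y"
            by (intro greatest) (use * in \<open>force simp: algebra_simps\<close>)
          then show "u (x + y) - u y \<le> q x"
            by simp
        qed
        then show "u (x + y) \<le> u x + u y"
          by simp
      next
        fix c :: real and x
        assume "c > 0"
        have "u (c *\<^sub>R x) / c \<le> u x"
        proof (rule greatest)
          fix q assume "q \<in> C"
          then show "u (c *\<^sub>R x) / c \<le> q x"
            using \<open>c > 0\<close> lower[of q "c *\<^sub>R x"] sublinear_scaleR[OF CA(1), of q c x]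
            by (simp add: field_simps)
        qed
        then show "u (c *\<^sub>R x) \<le> c * u x"
          using \<open>c > 0\<close> by (simp add: field_simps)
      qed
      moreover have "u \<le> p"
        using False lower CA(2) by (meson ex_in_conv le_fun_def order_trans)
      ultimately show ?thesis
        using lower by (auto simp: A_def le_fun_def)
    qed
  qed
  then obtain q where q: "sublinear q" "q \<le> p"
    and min: "\<And>r. sublinear r \<Longrightarrow> r \<le> q \<Longrightarrow> r = q"
    unfolding A_def by (metis (no_types, lifting) mem_Collect_eq order_trans)
  have odd: "q (- y) = - q y" for y
  proof -
    have "tilt q y = q"
      using tilt_le[OF q(1)] by (intro min sublinear_tilt q) (simp add: le_fun_def)
    then show ?thesis
      using tilt_minus[OF q(1), of y] sublinear_ge_minus[OF q(1), of "- y"] by simp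
  qed
  have "linear q"
  proof (rule linearI)
    fix x y
    show "q (x + y) = q x + q y"
      using sublinear_add[OF q(1), of x y] sublinear_add[OF q(1), of "x + y" "- y"] odd[of y]
      by simp
  next
    fix c x
    show "q (c *\<^sub>R x) = c *\<^sub>R q x"
      using sublinear_scaleR[OF q(1), of c x] sublinear_scaleR[OF q(1), of "- c" x] odd[of "c *\<^sub>R x"]
      by (cases "c \<ge> 0") auto
  qed
  with q(2) show ?thesis
    by (intro that) (auto simp: le_fun_def)
qed

lemma norm_blinfun_eq_1I:
  assumes "\<And>y. norm (blinfun_apply \<phi> y) \<le> norm y" and "norm (blinfun_apply \<phi> x) = norm x" "x \<noteq> 0"
  shows "norm \<phi> = 1"
proof (rule antisym)
  show "norm \<phi> \<le> 1"
    by (rule norm_blinfun_bound) (simp_all add: assms(1))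
  show "1 \<le> norm \<phi>"
    using norm_blinfun[of \<phi> x] assms(2,3) by simp
qed

lemma norm_blinfun_le_norm: "norm \<phi> = 1 \<Longrightarrow> norm (blinfun_apply \<phi> y) \<le> norm y"
  using norm_blinfun[of \<phi> y] by simp

definition support_functional :: "('a::real_normed_vector \<Rightarrow>\<^sub>L real) \<Rightarrow> 'a \<Rightarrow> bool"
  where "support_functional \<phi> x \<longleftrightarrow> norm \<phi> = 1 \<and> blinfun_apply \<phi> x = norm x"

lemma smooth_point_scaleR_iff:
  "smooth_point (scaleR :: real \<Rightarrow> 'a::real_normed_vector \<Rightarrow> 'a) x \<longleftrightarrow>
    x \<noteq> 0 \<and> (\<exists>!\<phi>. support_functional \<phi> x)"
  by (simp add: smooth_point_def dual_space_def support_functional_def blinfun.scaleR_right)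

text \<open>The Hahn-Banach argument starts from the tilt of the norm: a linear functional below it
  is below the norm, and at \<open>- x\<close> it is at most \<open>- norm x\<close>.\<close>

theorem support_functional_exists:
  fixes x :: "'a::real_normed_vector"
  assumes "x \<noteq> 0"
  obtains \<phi> where "support_functional \<phi> x"
proof -
  obtain q where q: "linear q" "\<And>y. q y \<le> tilt norm x y"
    using linear_below_sublinear[OF sublinear_tilt[OF sublinear_norm, of x]] by blast
  have le: "q y \<le> norm y" for y
    using q(2) tilt_le[OF sublinear_norm] by (rule order_trans)
  have abs_le: "norm (q y) \<le> norm y" for y
    using le[of y] le[of "- y"] by (auto simp: linear_neg[OF q(1)])
  have "bounded_linear q"
    using q(1) abs_le by (intro bounded_linear_intro[of _ 1]) (auto simp: linear_add linear_scale)
  then have apply_q: "blinfun_apply (Blinfun q) = q"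
    by (rule bounded_linear_Blinfun_apply)
  have "q x = norm x"
    using le[of x] q(2)[of "- x"] tilt_minus[OF sublinear_norm, of x]
    by (simp add: linear_neg[OF q(1)])
  then have "support_functional (Blinfun q) x"
    using abs_le assms unfolding support_functional_def
    by (intro conjI norm_blinfun_eq_1I[of _ x]) (auto simp: apply_q)
  then show ?thesis
    by (rule that)
qed


section \<open>Complex smoothness is real smoothness\<close>

text \<open>The imaginary part of \<open>\<phi> y\<close> is \<open>- Re (\<phi> (\<i> y))\<close>.\<close>

lemma complex_support_functional_eqI:
  assumes "\<phi> \<in> dual_space scaleC" "\<eta> \<in> dual_space scaleC"
    and "\<And>y. Re (blinfun_apply \<phi> y) = Re (blinfun_apply \<eta> y)"
  shows "\<phi> = \<eta>"
proof (rule blinfun_eqI, rule complex_eqI)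
  fix y
  show "Re (blinfun_apply \<phi> y) = Re (blinfun_apply \<eta> y)"
    by (rule assms)
  show "Im (blinfun_apply \<phi> y) = Im (blinfun_apply \<eta> y)"
    using assms(3)[of "scaleC \<i> y"] assms(1,2) by (simp add: dual_space_def)
qed

lemma Re_support_functional:
  assumes "norm \<phi> = 1" "blinfun_apply \<phi> x = of_real (norm x)" "x \<noteq> 0"
  shows "support_functional (blinfun_compose (Blinfun Re) \<phi>) x"
proof -
  have ap: "blinfun_apply (blinfun_compose (Blinfun Re) \<phi>) y = Re (blinfun_apply \<phi> y)" for y
    by (simp add: bounded_linear_Blinfun_apply[OF bounded_linear_Re])
  have "norm (Re (blinfun_apply \<phi> y)) \<le> norm y" for y
    using abs_Re_le_cmod[of "blinfun_apply \<phi> y"] norm_blinfun_le_norm[OF assms(1), of y] by simp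
  with assms show ?thesis
    unfolding support_functional_def
    by (intro conjI norm_blinfun_eq_1I[of _ x]) (auto simp del: blinfun_apply_blinfun_compose simp: ap)
qed

text \<open>The functional is \<open>u y - \<i> u (\<i> y)\<close>. Rotating \<open>y\<close> by a unimodular scalar makes its value real
  and nonnegative, where it is a value of \<open>u\<close>; hence it obeys the same norm bound as \<open>u\<close>.\<close>

lemma complexified_support_functional:
  fixes scaleC :: "complex \<Rightarrow> 'y::banach \<Rightarrow> 'y"
  assumes "banach_space_over scaleC" and u: "support_functional u x" and "x \<noteq> 0"
  obtains \<phi> where "\<phi> \<in> dual_space scaleC" "norm \<phi> = 1" "blinfun_apply \<phi> x = of_real (norm x)"
    "\<And>y. Re (blinfun_apply \<phi> y) = blinfun_apply u y"
proof -
  interpret banach_space_over scaleC by fact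
  have u1: "norm u = 1" and ux: "blinfun_apply u x = norm x"
    using u by (auto simp: support_functional_def)
  define F where "F y = Complex (blinfun_apply u y) (- blinfun_apply u (scaleC \<i> y))" for y
  have add: "F (y + z) = F y + F z" for y z
    by (simp add: F_def complex_eq_iff blinfun.add_right scale_right_distrib)
  have real: "F (r *\<^sub>R y) = r *\<^sub>R F y" for r y
    by (simp add: F_def complex_eq_iff blinfun.scaleR_right
        linear_scale[OF bounded_linear.linear[OF bounded_linear_scale]])
  have ii: "F (scaleC \<i> y) = \<i> * F y" for y
  proof -
    have "scaleC (- 1) y = - y"
      by simp
    then show ?thesis
      by (simp add: F_def complex_eq_iff blinfun.minus_right)
  qed
  have F_scale: "F (scaleC c y) = c * F y" for c y
  proof -
    have "c = of_real (Re c) + \<i> * of_real (Im c)"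
      by (simp add: complex_eq_iff)
    then have "scaleC c y = Re c *\<^sub>R y + scaleC \<i> (Im c *\<^sub>R y)"
      by (metis scale_left_distrib scale_scale smul_of_real)
    then show ?thesis
      by (simp add: add real ii complex_eq_iff)
  qed
  have bound: "norm (F y) \<le> norm y" for y
  proof (cases "F y = 0")
    case False
    define c where "c = cnj (F y) / of_real (norm (F y))"
    have c: "norm c = 1" "c * F y = of_real (norm (F y))"
      using False by (simp_all add: c_def norm_divide complex_norm_square[symmetric]
          power2_eq_square mult.commute[of "cnj _"])
    have "norm (F y) = Re (F (scaleC c y))"
      by (simp add: F_scale c)
    also have "\<dots> = blinfun_apply u (scaleC c y)"
      by (simp add: F_def)
    also have "\<dots> \<le> norm y"
      using norm_blinfun_le_norm[OF u1, of "scaleC c y"] by (simp add: norm_smul c)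
    finally show ?thesis .
  qed simp
  have "bounded_linear F"
    by (rule bounded_linear_intro[of _ 1]) (auto simp: add real bound)
  then have ap: "blinfun_apply (Blinfun F) = F"
    by (rule bounded_linear_Blinfun_apply)
  \<comment> \<open>The real part of \<open>F x\<close> already exhausts the bound \<open>norm x\<close>, which leaves no imaginary part.\<close>
  have "F x = of_real (norm x)"
  proof (rule complex_eqI)
    show re: "Re (F x) = Re (of_real (norm x))"
      by (simp add: F_def ux)
    have "(Re (F x))\<^sup>2 + (Im (F x))\<^sup>2 \<le> (norm x)\<^sup>2"
      using power_mono[OF bound[of x], of 2] by (simp add: cmod_power2)
    then show "Im (F x) = Im (of_real (norm x))"
      by (simp add: re)
  qed
  then show ?thesis
    using \<open>x \<noteq> 0\<close>
    by (intro that[of "Blinfun F"] norm_blinfun_eq_1I[of _ x])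
      (auto simp: ap bound dual_space_def F_scale, simp add: F_def)
qed

lemma ex1_mem_iff_card: "(\<exists>!x. x \<in> A) \<longleftrightarrow> card A = 1"
  by (auto simp: card_1_singleton_iff)

text \<open>Complexification inverts taking real parts, so the complex and the real support functionals
  at \<open>x\<close> are in bijection, and one set is a singleton exactly when the other is.\<close>

theorem smooth_point_complex_iff_real:
  fixes scaleC :: "complex \<Rightarrow> 'y::banach \<Rightarrow> 'y"
  assumes C: "banach_space_over scaleC"
  shows "smooth_point scaleC x \<longleftrightarrow> smooth_point (scaleR :: real \<Rightarrow> 'y \<Rightarrow> 'y) x"
proof (cases "x = 0")
  case False
  define S where "S = {\<phi>. \<phi> \<in> dual_space scaleC \<and> norm \<phi> = 1 \<and> blinfun_apply \<phi> x = of_real (norm x)}"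
  define R where "R = (\<lambda>\<phi>::'y \<Rightarrow>\<^sub>L complex. blinfun_compose (Blinfun Re) \<phi>)"
  have ap: "blinfun_apply (R \<phi>) y = Re (blinfun_apply \<phi> y)" for \<phi> y
    by (simp add: R_def bounded_linear_Blinfun_apply[OF bounded_linear_Re])
  have "bij_betw R S {u. support_functional u x}"
    unfolding bij_betw_def
  proof (intro conjI inj_onI equalityI subsetI)
    fix \<phi> \<eta> assume "\<phi> \<in> S" "\<eta> \<in> S" "R \<phi> = R \<eta>"
    then show "\<phi> = \<eta>"
      using ap by (intro complex_support_functional_eqI[of _ scaleC]) (auto simp: S_def, metis)
  next
    fix u assume "u \<in> R ` S"
    then show "u \<in> {u. support_functional u x}"
      using Re_support_functional False by (auto simp: S_def R_def)
  next
    fix u assume "u \<in> {u. support_functional u x}"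
    then obtain \<phi> where "\<phi> \<in> S" "\<And>y. Re (blinfun_apply \<phi> y) = blinfun_apply u y"
      using complexified_support_functional[OF C _ False, of u] unfolding S_def by blast
    then show "u \<in> R ` S"
      by (intro image_eqI[of _ _ \<phi>]) (auto intro!: blinfun_eqI simp: ap)
  qed
  then have "(\<exists>!\<phi>. \<phi> \<in> S) \<longleftrightarrow> (\<exists>!u. u \<in> {u. support_functional u x})"
    unfolding ex1_mem_iff_card by (simp add: bij_betw_same_card)
  with False show ?thesis
    by (simp add: smooth_point_def[of scaleC] smooth_point_scaleR_iff S_def)
qed (simp add: smooth_point_def)


section \<open>Peaks of functions vanishing at infinity\<close>

text \<open>Above a positive level the values of \<open>norm \<circ> f\<close> live on a compact set, so the maximum over \<open>S\<close>
  exists once some point of \<open>S\<close> reaches that level.\<close>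

lemma norm_attains_max_on_closed:
  fixes f :: "('k::t2_space, 'x::real_normed_vector) czero"
  assumes "e > 0" "closed S" "k \<in> S" "e \<le> norm (apply_czero f k)"
  obtains m where "m \<in> S" "\<And>k. k \<in> S \<Longrightarrow> norm (apply_czero f k) \<le> norm (apply_czero f m)"
proof -
  let ?C = "S \<inter> {k. e \<le> norm (apply_czero f k)}"
  have "compact ?C"
    using vanishes_apply_czero[of f] assms by (intro closed_Int_compact) (auto simp: vanishes_at_infinity_def)
  moreover have "continuous_on ?C (\<lambda>k. norm (apply_czero f k))"
    by (intro continuous_on_norm continuous_on_subset[OF continuous_on_apply_czero]) auto
  ultimately obtain m where m: "m \<in> ?C"
    "\<And>k. k \<in> ?C \<Longrightarrow> norm (apply_czero f k) \<le> norm (apply_czero f m)"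
    using assms continuous_attains_sup[of ?C "\<lambda>k. norm (apply_czero f k)"] by auto
  show ?thesis
  proof (rule that)
    fix k assume "k \<in> S"
    then show "norm (apply_czero f k) \<le> norm (apply_czero f m)"
      using m by (cases "e \<le> norm (apply_czero f k)") auto
  qed (use m in auto)
qed

lemma norm_attaining_set_nonempty:
  fixes f :: "('k::t2_space, 'x::real_normed_vector) czero"
  assumes "f \<noteq> 0"
  shows "norm_attaining_set f \<noteq> {}"
proof -
  obtain k where "apply_czero f k \<noteq> 0"
    using assms czero_eqI[of f 0] by auto
  then obtain m where "\<And>k. norm (apply_czero f k) \<le> norm (apply_czero f m)"
    using norm_attains_max_on_closed[of "norm (apply_czero f k)" UNIV k f] by auto
  then have "norm f = norm (apply_czero f m)"
    by (intro antisym norm_czero_least norm_czero_upper)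
  then show ?thesis
    by (auto simp: norm_attaining_set_def)
qed

text \<open>Off \<open>U\<close> the norm either stays below \<open>norm f / 2\<close> or attains a maximum, at a point that is not
  a peak.\<close>

lemma norm_bounded_away_from_peak:
  fixes f :: "('k::t2_space, 'x::real_normed_vector) czero"
  assumes "norm_attaining_set f \<subseteq> U" "open U" "f \<noteq> 0"
  obtains m where "m < norm f" "\<And>k. k \<notin> U \<Longrightarrow> norm (apply_czero f k) \<le> m"
proof (cases "\<exists>k. k \<notin> U \<and> norm f / 2 \<le> norm (apply_czero f k)")
  case True
  then obtain k where "k \<in> - U" "norm f / 2 \<le> norm (apply_czero f k)"
    by blast
  then obtain m where m: "m \<notin> U" "\<And>k. k \<notin> U \<Longrightarrow> norm (apply_czero f k) \<le> norm (apply_czero f m)"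
    using assms norm_attains_max_on_closed[of "norm f / 2" "- U" k f] by auto
  then have "norm (apply_czero f m) \<noteq> norm f"
    using assms(1) by (auto simp: norm_attaining_set_def)
  then show ?thesis
    using m norm_czero_upper[of f m] by (intro that[of "norm (apply_czero f m)"]) auto
next
  case False
  then show ?thesis
    using assms(3) by (intro that[of "norm f / 2"]) (auto simp: not_le intro: less_imp_le)
qed

lemma czero_with_values:
  fixes f :: "('k::topological_space, 'x::real_normed_vector) czero"
    and h :: "'k \<Rightarrow> 'z::real_normed_vector"
  assumes "continuous_on UNIV h" "\<And>k. norm (h k) \<le> b * norm (apply_czero f k)"
  obtains g where "\<And>k. apply_czero g k = h k"
proof -
  have "vanishes_at_infinity h"
    by (rule vanishes_bounded[OF assms(1) vanishes_apply_czero assms(2)])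
  then show ?thesis
    using assms(1) by (intro that[of "Czero h"]) (simp add: Czero_inverse)
qed

text \<open>These functions realise every direction at a point where \<open>f\<close> does not vanish; at a peak of \<open>f\<close>
  their norm is attained as well.\<close>

lemma czero_norm_times_vector:
  fixes f :: "('k::topological_space, 'x::real_normed_vector) czero" and x :: "'z::real_normed_vector"
  obtains g where "\<And>k. apply_czero g k = norm (apply_czero f k) *\<^sub>R x"
proof (rule czero_with_values[of "\<lambda>k. norm (apply_czero f k) *\<^sub>R x" "norm x" f])
  show "continuous_on UNIV (\<lambda>k. norm (apply_czero f k) *\<^sub>R x)"
    by (intro continuous_intros continuous_on_apply_czero)
qed (use that in \<open>auto simp: mult.commute\<close>)


section \<open>Evaluation functionals\<close>

definition eval_functional :: "('x::real_normed_vector \<Rightarrow>\<^sub>L real) \<Rightarrow> 'k::topological_space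
    \<Rightarrow> ('k, 'x) czero \<Rightarrow>\<^sub>L real"
  where "eval_functional \<psi> k = Blinfun (\<lambda>g. blinfun_apply \<psi> (apply_czero g k))"

lemma eval_functional_apply [simp]:
  "blinfun_apply (eval_functional \<psi> k) g = blinfun_apply \<psi> (apply_czero g k)"
proof -
  have "norm (blinfun_apply \<psi> (apply_czero g k)) \<le> norm g * norm \<psi>" for g
    using norm_blinfun[of \<psi> "apply_czero g k"] mult_left_mono[OF norm_czero_upper[of g k], of "norm \<psi>"]
    by (simp add: mult.commute)
  then have "bounded_linear (\<lambda>g. blinfun_apply \<psi> (apply_czero g k))"
    by (intro bounded_linear_intro) (auto simp: blinfun.add_right blinfun.scaleR_right)
  then show ?thesis
    by (simp add: eval_functional_def bounded_linear_Blinfun_apply)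
qed

lemma support_functional_eval:
  fixes f :: "('k::topological_space, 'x::real_normed_vector) czero"
  assumes "support_functional \<psi> (apply_czero f k)" "k \<in> norm_attaining_set f" "f \<noteq> 0"
  shows "support_functional (eval_functional \<psi> k) f"
proof -
  have psi: "norm \<psi> = 1" "blinfun_apply \<psi> (apply_czero f k) = norm f"
    using assms by (auto simp: support_functional_def norm_attaining_set_def)
  have "norm (blinfun_apply \<psi> (apply_czero g k)) \<le> norm g" for g :: "('k, 'x) czero"
    using norm_blinfun_le_norm[OF psi(1)] norm_czero_upper by (rule order_trans)
  with psi assms(3) show ?thesis
    unfolding support_functional_def by (intro conjI norm_blinfun_eq_1I[of _ f]) auto
qed

text \<open>Each support functional at each peak yields one of \<open>f\<close>. The functions \<open>w f\<close> distinguish those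
  of different peaks, and \<open>norm (f k) x\<close> those of the same peak.\<close>

lemma smooth_imp_single_smooth_peak:
  fixes f :: "('k::t2_space, 'x::real_normed_vector) czero"
  assumes lc: "locally_compact_space (euclidean :: 'k topology)"
    and smooth: "smooth_point (scaleR :: real \<Rightarrow> ('k, 'x) czero \<Rightarrow> ('k, 'x) czero) f"
  shows "\<exists>k0. norm_attaining_set f = {k0} \<and>
    smooth_point (scaleR :: real \<Rightarrow> 'x \<Rightarrow> 'x) (apply_czero f k0)"
proof -
  have f0: "f \<noteq> 0" and unique: "\<And>\<phi> \<eta>. support_functional \<phi> f \<Longrightarrow> support_functional \<eta> f \<Longrightarrow> \<phi> = \<eta>"
    using smooth by (auto simp: smooth_point_scaleR_iff)
  have peak0: "apply_czero f k \<noteq> 0" if "k \<in> norm_attaining_set f" for k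
    using that f0 by (auto simp: norm_attaining_set_def)
  obtain k0 where k0: "k0 \<in> norm_attaining_set f"
    using norm_attaining_set_nonempty[OF f0] by blast
  have "k = k0" if k: "k \<in> norm_attaining_set f" for k
  proof (rule ccontr)
    assume "k \<noteq> k0"
    have "Hausdorff_space (euclidean :: 'k topology)"
      by (simp add: Hausdorff_space_def disjnt_def) (metis hausdorff)
    then have "completely_regular_space (euclidean :: 'k topology)"
      using locally_compact_regular_imp_completely_regular_space[OF lc] by blast
    then obtain w :: "'k \<Rightarrow> real" where w: "continuous_map euclidean (top_of_set {0..1}) w" "w k = 0" "w k0 = 1"
      using \<open>k \<noteq> k0\<close> unfolding completely_regular_space_def
      by (metis (no_types, lifting) Diff_iff UNIV_I closed_closedin closed_singleton image_subset_iff
          singletonD singletonI topspace_euclidean)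
    from w(1) have contw: "continuous_on UNIV w" and w01: "\<And>k. 0 \<le> w k" "\<And>k. w k \<le> 1"
      by (auto simp: continuous_map_in_subtopology image_subset_iff Pi_iff)
    have "norm (w k *\<^sub>R apply_czero f k) \<le> 1 * norm (apply_czero f k)" for k
      using w01[of k] mult_right_mono[of "w k" 1 "norm (apply_czero f k)"] by simp
    moreover have "continuous_on UNIV (\<lambda>k. w k *\<^sub>R apply_czero f k)"
      by (intro continuous_intros contw continuous_on_apply_czero)
    ultimately obtain g where g: "\<And>k. apply_czero g k = w k *\<^sub>R apply_czero f k"
      using czero_with_values by blast
    obtain \<psi> \<psi>0 where psi: "support_functional \<psi> (apply_czero f k)"
        "support_functional \<psi>0 (apply_czero f k0)"
      using support_functional_exists peak0 k k0 by metis
    have "eval_functional \<psi> k = eval_functional \<psi>0 k0"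
      by (intro unique support_functional_eval psi k k0 f0)
    then have "blinfun_apply \<psi> (apply_czero g k) = blinfun_apply \<psi>0 (apply_czero g k0)"
      by (metis eval_functional_apply)
    then have "norm (apply_czero f k0) = 0"
      using psi(2) by (simp add: g w support_functional_def)
    then show False
      using peak0[OF k0] by simp
  qed
  then have single: "norm_attaining_set f = {k0}"
    using k0 by blast
  have "\<psi> = \<eta>" if psi: "support_functional \<psi> (apply_czero f k0)" "support_functional \<eta> (apply_czero f k0)" for \<psi> \<eta>
  proof (rule blinfun_eqI)
    fix x
    obtain g :: "('k, 'x) czero" where g: "\<And>k. apply_czero g k = norm (apply_czero f k) *\<^sub>R x"
      using czero_norm_times_vector by blast
    have "eval_functional \<psi> k0 = eval_functional \<eta> k0"
      by (intro unique support_functional_eval psi k0 f0)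
    then have "blinfun_apply \<psi> (apply_czero g k0) = blinfun_apply \<eta> (apply_czero g k0)"
      by (metis eval_functional_apply)
    then show "blinfun_apply \<psi> x = blinfun_apply \<eta> x"
      using peak0[OF k0] by (simp add: g blinfun.scaleR_right)
  qed
  then show ?thesis
    using single peak0[OF k0] support_functional_exists[OF peak0[OF k0]]
    by (metis smooth_point_scaleR_iff)
qed


section \<open>A single peak localises the support functionals\<close>

text \<open>Away from \<open>U\<close> there is a gap below \<open>norm f\<close>, so \<open>norm (f + t g) \<le> norm f\<close> for a small \<open>t > 0\<close>.
  Then \<open>norm f + t \<phi> g = \<phi> (f + t g) \<le> norm f\<close> forces \<open>\<phi> g \<le> 0\<close>, and the same holds for \<open>- g\<close>.\<close>

lemma support_functional_zero_near_peak:
  fixes f :: "('k::t2_space, 'x::real_normed_vector) czero"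
  assumes supp: "support_functional \<phi> f" and "f \<noteq> 0"
    and U: "open U" "norm_attaining_set f \<subseteq> U" and g: "\<And>k. k \<in> U \<Longrightarrow> apply_czero g k = 0"
  shows "blinfun_apply \<phi> g = 0"
proof -
  have le0: "blinfun_apply \<phi> g \<le> 0" if g: "\<And>k. k \<in> U \<Longrightarrow> apply_czero g k = 0" for g
  proof -
    obtain m where m: "m < norm f" "\<And>k. k \<notin> U \<Longrightarrow> norm (apply_czero f k) \<le> m"
      using norm_bounded_away_from_peak[OF U(2,1) \<open>f \<noteq> 0\<close>] by blast
    define t where "t = (norm f - m) / (1 + norm g)"
    have t: "t > 0"
      using m(1) by (simp add: t_def add_pos_nonneg)
    have tg: "t * norm g \<le> norm f - m"
    proof -
      have "t * norm g \<le> t * (1 + norm g)"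
        using t by simp
      also have "\<dots> = norm f - m"
        using norm_ge_zero[of g] by (simp add: t_def del: norm_ge_zero)
      finally show ?thesis .
    qed
    have "norm (f + t *\<^sub>R g) \<le> norm f"
    proof (rule norm_czero_least)
      fix k
      show "norm (apply_czero (f + t *\<^sub>R g) k) \<le> norm f"
      proof (cases "k \<in> U")
        case True
        then show ?thesis
          by (simp add: g norm_czero_upper)
      next
        case False
        have "norm (apply_czero f k + t *\<^sub>R apply_czero g k)
            \<le> norm (apply_czero f k) + t * norm (apply_czero g k)"
          using norm_triangle_ineq[of "apply_czero f k" "t *\<^sub>R apply_czero g k"] t by simp
        also have "\<dots> \<le> m + t * norm g"
          using m(2)[OF False] t by (intro add_mono mult_left_mono norm_czero_upper) auto
        finally show ?thesis
          using tg by simp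
      qed
    qed
    then have "blinfun_apply \<phi> (f + t *\<^sub>R g) \<le> norm f"
      using norm_blinfun_le_norm[of \<phi> "f + t *\<^sub>R g"] supp by (simp add: support_functional_def)
    then show ?thesis
      using supp t by (simp add: support_functional_def blinfun.add_right blinfun.scaleR_right
          mult_le_0_iff)
  qed
  show ?thesis
    using le0[of g] le0[of "- g"] g by (simp add: blinfun.minus_right)
qed

text \<open>Shortening every value of \<open>g\<close> by \<open>e\<close>, and values of norm at most \<open>e\<close> to zero, moves \<open>g\<close> by at
  most \<open>e\<close> and makes it vanish near the peak.\<close>

lemma support_functional_zero_at_peak:
  fixes f :: "('k::t2_space, 'x::real_normed_vector) czero"
  assumes supp: "support_functional \<phi> f" and "f \<noteq> 0"
    and peak: "norm_attaining_set f = {k0}" and g0: "apply_czero g k0 = 0"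
  shows "blinfun_apply \<phi> g = 0"
proof -
  have small: "norm (blinfun_apply \<phi> g) \<le> e" if "e > 0" for e
  proof -
    \<comment> \<open>The truncation factor; the maximum in the denominator keeps it continuous where \<open>g\<close> vanishes.\<close>
    define s where "s k = max 0 (norm (apply_czero g k) - e) / max (norm (apply_czero g k)) e" for k
    have s01: "0 \<le> s k" "s k \<le> 1" for k
      using \<open>e > 0\<close> by (auto simp: s_def divide_le_eq max_def)
    have "continuous_on UNIV (\<lambda>k. s k *\<^sub>R apply_czero g k)"
      unfolding s_def using \<open>e > 0\<close>
      by (intro continuous_intros continuous_on_apply_czero) (auto simp: max_def)
    moreover have "norm (s k *\<^sub>R apply_czero g k) \<le> 1 * norm (apply_czero g k)" for k
      using s01[of k] mult_right_mono[of "s k" 1 "norm (apply_czero g k)"] by simp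
    ultimately obtain h where h: "\<And>k. apply_czero h k = s k *\<^sub>R apply_czero g k"
      using czero_with_values by blast
    define U where "U = {k. norm (apply_czero g k) < e}"
    have "open U"
      unfolding U_def by (intro open_Collect_less continuous_intros continuous_on_apply_czero)
    moreover have "norm_attaining_set f \<subseteq> U"
      using \<open>e > 0\<close> g0 by (simp add: peak U_def)
    moreover have "apply_czero h k = 0" if "k \<in> U" for k
      using that by (simp add: U_def h s_def)
    ultimately have "blinfun_apply \<phi> h = 0"
      using support_functional_zero_near_peak[OF supp \<open>f \<noteq> 0\<close>] by blast
    moreover have "norm (g - h) \<le> e"
    proof (rule norm_czero_least)
      fix k
      have "apply_czero (g - h) k = (1 - s k) *\<^sub>R apply_czero g k"
        by (simp add: h algebra_simps)
      then have "norm (apply_czero (g - h) k) = (1 - s k) * norm (apply_czero g k)"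
        using s01[of k] by simp
      also have "\<dots> \<le> e"
      proof (cases "norm (apply_czero g k) \<le> e")
        case False
        then have "s k * norm (apply_czero g k) = norm (apply_czero g k) - e"
          using \<open>e > 0\<close> by (auto simp: s_def max_def)
        then show ?thesis
          by (simp add: left_diff_distrib)
      qed (use \<open>e > 0\<close> in \<open>auto simp: s_def max_def\<close>)
      finally show "norm (apply_czero (g - h) k) \<le> e" .
    qed
    ultimately show ?thesis
      using norm_blinfun_le_norm[of \<phi> "g - h"] supp
      by (simp add: support_functional_def blinfun.diff_right)
  qed
  then show ?thesis
    using field_le_epsilon[of "norm (blinfun_apply \<phi> g)" 0] by simp
qed

text \<open>The functional \<open>\<psi>\<close> applies \<open>\<phi>\<close> to an extension of the vector \<open>x\<close> to a function with value \<open>x\<close> at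
  the peak. The extension \<open>norm (f k) / norm f * x\<close> is linear in \<open>x\<close> and norm-preserving, which makes
  \<open>\<psi>\<close> linear of norm at most \<open>1\<close>. It represents \<open>\<phi>\<close> because \<open>g\<close> and the extension of \<open>g k\<^sub>0\<close> differ by a
  function that vanishes at \<open>k\<^sub>0\<close>.\<close>

lemma support_functional_is_eval:
  fixes f :: "('k::t2_space, 'x::real_normed_vector) czero"
  assumes supp: "support_functional \<phi> f" and "f \<noteq> 0" and peak: "norm_attaining_set f = {k0}"
  obtains \<psi> where "support_functional \<psi> (apply_czero f k0)" "\<phi> = eval_functional \<psi> k0"
proof -
  have fk0: "norm (apply_czero f k0) = norm f"
    using peak by (auto simp: norm_attaining_set_def)
  have phi1: "norm \<phi> = 1" and phif: "blinfun_apply \<phi> f = norm f"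
    using supp by (auto simp: support_functional_def)
  have "\<exists>g. \<forall>k. apply_czero g k = (norm (apply_czero f k) / norm f) *\<^sub>R x" for x :: 'x
    using czero_norm_times_vector[of f "x /\<^sub>R norm f"] by (metis divide_inverse scaleR_scaleR)
  then obtain B :: "'x \<Rightarrow> ('k, 'x) czero"
    where B: "\<And>x k. apply_czero (B x) k = (norm (apply_czero f k) / norm f) *\<^sub>R x"
    by metis
  have B_add: "B (x + y) = B x + B y" and B_scale: "B (r *\<^sub>R x) = r *\<^sub>R B x" for x y r
    by (auto intro!: czero_eqI simp: B algebra_simps)
  have B_norm: "norm (B x) \<le> norm x" for x
  proof (rule norm_czero_least)
    fix k
    have "norm (apply_czero f k) / norm f \<le> 1"
      using \<open>f \<noteq> 0\<close> norm_czero_upper[of f k] by simp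
    then show "norm (apply_czero (B x) k) \<le> norm x"
      using mult_right_mono[of "norm (apply_czero f k) / norm f" 1 "norm x"] by (simp add: B)
  qed
  have bound: "\<bar>blinfun_apply \<phi> (B x)\<bar> \<le> norm x" for x
    using norm_blinfun_le_norm[OF phi1, of "B x"] B_norm[of x] by simp
  have "bounded_linear (\<lambda>x. blinfun_apply \<phi> (B x))"
    by (rule bounded_linear_intro[of _ 1])
      (auto simp: B_add B_scale blinfun.add_right blinfun.scaleR_right bound)
  then have ap: "blinfun_apply (Blinfun (\<lambda>x. blinfun_apply \<phi> (B x))) x = blinfun_apply \<phi> (B x)" for x
    by (simp add: bounded_linear_Blinfun_apply)
  have phi_eval: "blinfun_apply \<phi> g = blinfun_apply \<phi> (B (apply_czero g k0))" for g
  proof -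
    have "apply_czero (g - B (apply_czero g k0)) k0 = 0"
      using \<open>f \<noteq> 0\<close> by (simp add: B fk0)
    from support_functional_zero_at_peak[OF supp \<open>f \<noteq> 0\<close> peak this] show ?thesis
      by (simp add: blinfun.diff_right)
  qed
  show ?thesis
  proof (rule that)
    show "support_functional (Blinfun (\<lambda>x. blinfun_apply \<phi> (B x))) (apply_czero f k0)"
      unfolding support_functional_def
    proof (intro conjI norm_blinfun_eq_1I[of _ "apply_czero f k0"])
      show "apply_czero f k0 \<noteq> 0"
        using fk0 \<open>f \<noteq> 0\<close> by auto
    qed (auto simp: ap bound phi_eval[symmetric] phif fk0)
    show "\<phi> = eval_functional (Blinfun (\<lambda>x. blinfun_apply \<phi> (B x))) k0"
      by (rule blinfun_eqI) (simp add: ap phi_eval[symmetric])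
  qed
qed

lemma single_smooth_peak_imp_smooth:
  fixes f :: "('k::t2_space, 'x::real_normed_vector) czero"
  assumes peak: "norm_attaining_set f = {k0}"
    and smooth: "smooth_point (scaleR :: real \<Rightarrow> 'x \<Rightarrow> 'x) (apply_czero f k0)"
  shows "smooth_point (scaleR :: real \<Rightarrow> ('k, 'x) czero \<Rightarrow> ('k, 'x) czero) f"
proof -
  have f0: "f \<noteq> 0"
    using smooth by (auto simp: smooth_point_def)
  obtain \<psi> where psi: "support_functional \<psi> (apply_czero f k0)"
    and unique: "\<And>\<eta>. support_functional \<eta> (apply_czero f k0) \<Longrightarrow> \<eta> = \<psi>"
    using smooth by (auto simp: smooth_point_scaleR_iff)
  have "support_functional (eval_functional \<psi> k0) f"
    using psi peak f0 by (intro support_functional_eval) auto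
  moreover have "\<phi> = eval_functional \<psi> k0" if "support_functional \<phi> f" for \<phi>
    using support_functional_is_eval[OF that f0 peak] unique by metis
  ultimately show ?thesis
    using f0 by (auto simp: smooth_point_scaleR_iff)
qed


section \<open>Smooth points of the function space\<close>

theorem theorem2p10:
  fixes f :: "('k::t2_space, 'x::banach) czero"
  assumes "locally_compact_space (euclidean :: 'k topology)"
  shows "(smooth_point (scaleR :: real \<Rightarrow> ('k, 'x) czero \<Rightarrow> ('k, 'x) czero) f \<longleftrightarrow>
            (\<exists>k0. norm_attaining_set f = {k0} \<and>
                  smooth_point (scaleR :: real \<Rightarrow> 'x \<Rightarrow> 'x) (apply_czero f k0)))
       \<and> (\<forall>scaleC :: complex \<Rightarrow> 'x \<Rightarrow> 'x. banach_space_over scaleC \<longrightarrow>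
            (smooth_point (czero_scale scaleC) f \<longleftrightarrow>
              (\<exists>k0. norm_attaining_set f = {k0} \<and> smooth_point scaleC (apply_czero f k0))))"
proof -
  have real: "smooth_point (scaleR :: real \<Rightarrow> ('k, 'x) czero \<Rightarrow> ('k, 'x) czero) f \<longleftrightarrow>
      (\<exists>k0. norm_attaining_set f = {k0} \<and> smooth_point (scaleR :: real \<Rightarrow> 'x \<Rightarrow> 'x) (apply_czero f k0))"
    using smooth_imp_single_smooth_peak[OF assms] single_smooth_peak_imp_smooth by blast
  moreover have "smooth_point (czero_scale scaleC) f \<longleftrightarrow>
      (\<exists>k0. norm_attaining_set f = {k0} \<and> smooth_point scaleC (apply_czero f k0))"
    if C: "banach_space_over scaleC" for scaleC :: "complex \<Rightarrow> 'x \<Rightarrow> 'x"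
    using real smooth_point_complex_iff_real[OF C]
      smooth_point_complex_iff_real[OF banach_space_over.banach_space_over_czero_scale[OF C], of f]
    by simp
  ultimately show ?thesis
    by blast
qed

end
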